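(* Let $\mathcal E\xrightarrow{Q}\mathcal D\xrightarrow{P}\mathcal B$ be a composable pair of Grothendieck fibrations. Then every $Q$-Cartesian morphism $k$ of $\mathcal E$ can be decomposed as $k=h\circ v$, where $h$ is Cartesian for the composite fibration $P\circ Q\colon\mathcal E\to\mathcal B$ and $v$ is a Cartesian morphism of a fibre fibration $Q_A\colon\mathcal E_A\to\mathcal D_A$, for some $A\in\mathcal B$.
   Context: For $A\in\mathcal B$, $\mathcal D_A$ is the fibre of $P$ over $A$ and $\mathcal E_A$ is the fibre of $P\circ Q$ over $A$ (objects over $A$ and morphisms over $1_A$). The fibre fibration $Q_A\colon\mathcal E_A\to\mathcal D_A$ is the restriction of $Q$; it is a fibration. The composite $P\circ Q$ is also a fibration. An arrow $h\colon D\to E$ over $f$ is Cartesian for a functor $R$ if for all $k\colon K\to E$ and $g$ with $f\circ g=R(k)$ there is a unique $l\colon K\to D$ over $g$ with $h\circ l=k$. *)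

theory Defs
  imports "HOL-Library.FuncSet"
begin

text \<open>
  Categories are given by carrier sets of objects and arrows; the operations are constrained on
  the carriers only. Composition is written in the classical order:
  \<open>g \<odot>\<^bsub>C\<^esub> f\<close> is ``first \<open>f\<close>, then \<open>g\<close>'', and is meaningful when \<open>Cod C f = Dom C g\<close>.
\<close>

record ('o, 'a) category =
  Obj :: "'o set"
  Arr :: "'a set"
  Dom :: "'a \<Rightarrow> 'o"
  Cod :: "'a \<Rightarrow> 'o"
  Ident :: "'o \<Rightarrow> 'a"
  Comp :: "'a \<Rightarrow> 'a \<Rightarrow> 'a" (infixl "\<odot>\<index>" 70)

definition Hom :: "('o, 'a) category \<Rightarrow> 'o \<Rightarrow> 'o \<Rightarrow> 'a set" where
  "Hom C X Y = {f \<in> Arr C. Dom C f = X \<and> Cod C f = Y}"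

locale category =
  fixes C :: "('o, 'a) category" (structure)
  assumes Dom_in: "f \<in> Arr C \<Longrightarrow> Dom C f \<in> Obj C"
    and Cod_in: "f \<in> Arr C \<Longrightarrow> Cod C f \<in> Obj C"
    and Ident_in: "X \<in> Obj C \<Longrightarrow> Ident C X \<in> Hom C X X"
    and Comp_in: "f \<in> Hom C X Y \<Longrightarrow> g \<in> Hom C Y Z \<Longrightarrow> g \<odot> f \<in> Hom C X Z"
    and Comp_Ident: "f \<in> Hom C X Y \<Longrightarrow> f \<odot> Ident C X = f"
    and Ident_Comp: "f \<in> Hom C X Y \<Longrightarrow> Ident C Y \<odot> f = f"
    and Comp_assoc: "f \<in> Hom C W X \<Longrightarrow> g \<in> Hom C X Y \<Longrightarrow> h \<in> Hom C Y Z \<Longrightarrow>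
          (h \<odot> g) \<odot> f = h \<odot> (g \<odot> f)"

record ('o, 'a, 'p, 'b) functor_maps =
  omap :: "'o \<Rightarrow> 'p"
  amap :: "'a \<Rightarrow> 'b"

locale is_functor = source: category C + target: category D
  for C :: "('o, 'a) category" and D :: "('p, 'b) category" +
  fixes F :: "('o, 'a, 'p, 'b) functor_maps"
  assumes omap_in: "X \<in> Obj C \<Longrightarrow> omap F X \<in> Obj D"
    and amap_in: "f \<in> Hom C X Y \<Longrightarrow> amap F f \<in> Hom D (omap F X) (omap F Y)"
    and amap_Ident: "X \<in> Obj C \<Longrightarrow> amap F (Ident C X) = Ident D (omap F X)"
    and amap_Comp: "f \<in> Hom C X Y \<Longrightarrow> g \<in> Hom C Y Z \<Longrightarrow>
          amap F (g \<odot>\<^bsub>C\<^esub> f) = amap F g \<odot>\<^bsub>D\<^esub> amap F f"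

definition comp_functor ::
  "('p, 'b, 'q, 'c) functor_maps \<Rightarrow> ('o, 'a, 'p, 'b) functor_maps \<Rightarrow> ('o, 'a, 'q, 'c) functor_maps"
  (infixl "\<circ>\<^sub>F" 55) where
  "G \<circ>\<^sub>F F = \<lparr>omap = omap G \<circ> omap F, amap = amap G \<circ> amap F\<rparr>"

text \<open>The first two arguments are the source and the target of the functor \<open>R\<close>.\<close>

definition cartesian ::
  "('o, 'a) category \<Rightarrow> ('p, 'b) category \<Rightarrow> ('o, 'a, 'p, 'b) functor_maps \<Rightarrow> 'a \<Rightarrow> bool" where
  "cartesian E B R h \<longleftrightarrow> h \<in> Arr E \<and>
     (\<forall>K. \<forall>k \<in> Hom E K (Cod E h). \<forall>g \<in> Hom B (omap R K) (omap R (Dom E h)).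
        amap R h \<odot>\<^bsub>B\<^esub> g = amap R k \<longrightarrow>
        (\<exists>!l. l \<in> Hom E K (Dom E h) \<and> amap R l = g \<and> h \<odot>\<^bsub>E\<^esub> l = k))"

locale fibration = is_functor +
  assumes cartesian_lift: "X \<in> Obj C \<Longrightarrow> f \<in> Arr D \<Longrightarrow> Cod D f = omap F X \<Longrightarrow>
            \<exists>h. cartesian C D F h \<and> Cod C h = X \<and> amap F h = f"

definition fibre ::
  "('o, 'a) category \<Rightarrow> ('p, 'b) category \<Rightarrow> ('o, 'a, 'p, 'b) functor_maps \<Rightarrow> 'p \<Rightarrow> ('o, 'a) category"
  where
  "fibre E B R A = E\<lparr>Obj := {X \<in> Obj E. omap R X = A}, Arr := {f \<in> Arr E. amap R f = Ident B A}\<rparr>"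

definition restrict_functor ::
  "('o, 'a, 'p, 'b) functor_maps \<Rightarrow> ('o, 'a) category \<Rightarrow> ('o, 'a, 'p, 'b) functor_maps" where
  "restrict_functor F S = \<lparr>omap = restrict (omap F) (Obj S), amap = restrict (amap F) (Arr S)\<rparr>"

text \<open>\<open>fibre_functor E B P Q A\<close> is the functor \<open>Q\<^sub>A\<close> from the fibre of \<open>P \<circ>\<^sub>F Q\<close> over \<open>A\<close> to the
  fibre of \<open>P\<close> over \<open>A\<close>, for \<open>Q\<close> with source \<open>E\<close> and \<open>P\<close> with target \<open>B\<close>.\<close>

definition fibre_functor ::
  "('e, 'ea) category \<Rightarrow> ('b, 'ba) category \<Rightarrow> ('d, 'da, 'b, 'ba) functor_maps \<Rightarrow>
   ('e, 'ea, 'd, 'da) functor_maps \<Rightarrow> 'b \<Rightarrow> ('e, 'ea, 'd, 'da) functor_maps" where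
  "fibre_functor E B P Q A = restrict_functor Q (fibre E B (P \<circ>\<^sub>F Q) A)"

lemma comp_functor_simps [simp]:
  "omap (G \<circ>\<^sub>F F) X = omap G (omap F X)" "amap (G \<circ>\<^sub>F F) f = amap G (amap F f)"
  by (simp_all add: comp_functor_def)

lemma HomI: "f \<in> Arr C \<Longrightarrow> f \<in> Hom C (Dom C f) (Cod C f)"
  by (simp add: Hom_def)

lemma fibre_simps [simp]:
  "Obj (fibre E B R A) = {X \<in> Obj E. omap R X = A}"
  "Arr (fibre E B R A) = {f \<in> Arr E. amap R f = Ident B A}"
  "Dom (fibre E B R A) = Dom E" "Cod (fibre E B R A) = Cod E"
  "Ident (fibre E B R A) = Ident E" "Comp (fibre E B R A) = Comp E"
  by (simp_all add: fibre_def)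

lemma Hom_fibre:
  "Hom (fibre E B R A) X Y = {f \<in> Hom E X Y. amap R f = Ident B A}"
  by (auto simp: Hom_def)

lemma is_functor_comp:
  assumes "is_functor E D Q" "is_functor D B P"
  shows "is_functor E B (P \<circ>\<^sub>F Q)"
proof -
  interpret Q: is_functor E D Q by fact
  interpret P: is_functor D B P by fact
  show ?thesis
    by unfold_locales
      (auto simp: Q.omap_in P.omap_in Q.amap_Ident P.amap_Ident Q.amap_Comp
        intro: P.amap_in Q.amap_in P.amap_Comp)
qed

lemma (in is_functor) amap_ArrD:
  assumes "f \<in> Arr C"
  shows "amap F f \<in> Arr D" "Dom D (amap F f) = omap F (Dom C f)" "Cod D (amap F f) = omap F (Cod C f)"
  using amap_in[OF HomI[OF assms]] by (auto simp: Hom_def)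

lemma (in is_functor) fibre_objects:
  assumes "A \<in> Obj D" "f \<in> Arr C" "amap F f = Ident D A"
  shows "omap F (Dom C f) = A" "omap F (Cod C f) = A"
  using amap_ArrD[OF assms(2)] target.Ident_in[OF assms(1)] assms(3) by (auto simp: Hom_def)

lemma (in is_functor) category_fibre:
  assumes A: "A \<in> Obj D"
  shows "category (fibre C D F A)"
proof -
  have "Ident D A \<in> Hom D A A" using A by (rule target.Ident_in)
  then have [simp]: "Ident D A \<odot>\<^bsub>D\<^esub> Ident D A = Ident D A" by (rule target.Comp_Ident)
  show ?thesis
    by unfold_locales
      (auto simp: Hom_fibre fibre_objects[OF A] source.Dom_in source.Cod_in source.Ident_in
        amap_Ident amap_Comp source.Comp_Ident source.Ident_Comp
        intro: source.Comp_in source.Comp_assoc)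
qed

lemma is_functor_fibre_functor:
  assumes Q: "is_functor E D Q" and P: "is_functor D B P" and A: "A \<in> Obj B"
  shows "is_functor (fibre E B (P \<circ>\<^sub>F Q) A) (fibre D B P A) (fibre_functor E B P Q A)"
proof -
  interpret Q: is_functor E D Q by fact
  interpret P: is_functor D B P by fact
  interpret PQ: is_functor E B "P \<circ>\<^sub>F Q" using Q P by (rule is_functor_comp)
  interpret EA: category "fibre E B (P \<circ>\<^sub>F Q) A" using A by (rule PQ.category_fibre)
  interpret DA: category "fibre D B P A" using A by (rule P.category_fibre)
  let ?E = "fibre E B (P \<circ>\<^sub>F Q) A"
  have o: "omap (fibre_functor E B P Q A) X = omap Q X" if "X \<in> Obj ?E" for X
    using that by (simp add: fibre_functor_def restrict_functor_def)
  have a: "amap (fibre_functor E B P Q A) f = amap Q f" if "f \<in> Hom ?E X Y" for f X Y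
    using that by (simp add: fibre_functor_def restrict_functor_def Hom_def)
  show ?thesis
  proof unfold_locales
    fix X assume X: "X \<in> Obj ?E"
    then show "omap (fibre_functor E B P Q A) X \<in> Obj (fibre D B P A)"
      using o[OF X] by (simp add: Q.omap_in)
    show "amap (fibre_functor E B P Q A) (Ident ?E X)
        = Ident (fibre D B P A) (omap (fibre_functor E B P Q A) X)"
      using a[OF EA.Ident_in[OF X]] o[OF X] X by (simp add: Q.amap_Ident)
  next
    fix f X Y assume f: "f \<in> Hom ?E X Y"
    then have XY: "X \<in> Obj ?E" "Y \<in> Obj ?E" using EA.Dom_in EA.Cod_in unfolding Hom_def by blast+
    show "amap (fibre_functor E B P Q A) f
        \<in> Hom (fibre D B P A) (omap (fibre_functor E B P Q A) X) (omap (fibre_functor E B P Q A) Y)"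
      unfolding o[OF XY(1)] o[OF XY(2)] a[OF f] using f by (auto simp: Hom_fibre intro: Q.amap_in)
  next
    fix f g X Y Z assume f: "f \<in> Hom ?E X Y" and g: "g \<in> Hom ?E Y Z"
    show "amap (fibre_functor E B P Q A) (g \<odot>\<^bsub>?E\<^esub> f)
        = amap (fibre_functor E B P Q A) g \<odot>\<^bsub>fibre D B P A\<^esub> amap (fibre_functor E B P Q A) f"
      unfolding a[OF EA.Comp_in[OF f g]] a[OF f] a[OF g]
      using f g by (auto simp: Hom_fibre intro: Q.amap_Comp)
  qed
qed

lemma cartesian_comp:
  assumes Q: "is_functor E D Q" and P: "is_functor D B P"
    and h: "cartesian E D Q h" and u: "cartesian D B P (amap Q h)"
  shows "cartesian E B (P \<circ>\<^sub>F Q) h"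
proof -
  interpret Q: is_functor E D Q by fact
  interpret P: is_functor D B P by fact
  have hA: "h \<in> Arr E" using h by (simp add: cartesian_def)
  note Qh = Q.amap_ArrD[OF hA]
  show ?thesis
    unfolding cartesian_def
  proof (intro conjI allI ballI impI hA)
    fix K k g
    assume k: "k \<in> Hom E K (Cod E h)"
      and g: "g \<in> Hom B (omap (P \<circ>\<^sub>F Q) K) (omap (P \<circ>\<^sub>F Q) (Dom E h))"
      and eq: "amap (P \<circ>\<^sub>F Q) h \<odot>\<^bsub>B\<^esub> g = amap (P \<circ>\<^sub>F Q) k"
    have "\<exists>!w. w \<in> Hom D (omap Q K) (omap Q (Dom E h)) \<and> amap P w = g
        \<and> amap Q h \<odot>\<^bsub>D\<^esub> w = amap Q k"
      using u g eq Q.amap_in[OF k] unfolding cartesian_def Qh by simp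
    then obtain w where w: "w \<in> Hom D (omap Q K) (omap Q (Dom E h))" "amap P w = g"
        "amap Q h \<odot>\<^bsub>D\<^esub> w = amap Q k"
      and w_unique: "\<And>w'. w' \<in> Hom D (omap Q K) (omap Q (Dom E h)) \<Longrightarrow> amap P w' = g \<Longrightarrow>
        amap Q h \<odot>\<^bsub>D\<^esub> w' = amap Q k \<Longrightarrow> w' = w"
      by blast
    have ex: "\<exists>!l. l \<in> Hom E K (Dom E h) \<and> amap Q l = w \<and> h \<odot>\<^bsub>E\<^esub> l = k"
      using h k w unfolding cartesian_def by blast
    have over: "amap Q l = w" if "l \<in> Hom E K (Dom E h)" "amap (P \<circ>\<^sub>F Q) l = g" "h \<odot>\<^bsub>E\<^esub> l = k" for l
      using that Q.amap_in[OF that(1)] Q.amap_Comp[OF that(1) HomI[OF hA]] by (intro w_unique) auto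
    show "\<exists>!l. l \<in> Hom E K (Dom E h) \<and> amap (P \<circ>\<^sub>F Q) l = g \<and> h \<odot>\<^bsub>E\<^esub> l = k"
      using ex over w(2) by (metis comp_functor_simps(2))
  qed
qed

lemma fibration_comp:
  assumes Q: "fibration E D Q" and P: "fibration D B P"
  shows "fibration E B (P \<circ>\<^sub>F Q)"
proof -
  interpret Q: fibration E D Q by fact
  interpret P: fibration D B P by fact
  interpret PQ: is_functor E B "P \<circ>\<^sub>F Q"
    using Q.is_functor_axioms P.is_functor_axioms by (rule is_functor_comp)
  show ?thesis
  proof unfold_locales
    fix X f assume X: "X \<in> Obj E" and f: "f \<in> Arr B" "Cod B f = omap (P \<circ>\<^sub>F Q) X"
    obtain u where u: "cartesian D B P u" "Cod D u = omap Q X" "amap P u = f"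
      using P.cartesian_lift[OF Q.omap_in[OF X] f(1)] f(2) by auto
    moreover obtain h where h: "cartesian E D Q h" "Cod E h = X" "amap Q h = u"
      using Q.cartesian_lift[OF X _ u(2)] u(1) unfolding cartesian_def by blast
    ultimately show "\<exists>h. cartesian E B (P \<circ>\<^sub>F Q) h \<and> Cod E h = X \<and> amap (P \<circ>\<^sub>F Q) h = f"
      using cartesian_comp[OF Q.is_functor_axioms P.is_functor_axioms] by auto
  qed
qed

lemma fibration_fibre_functor:
  assumes Q: "fibration E D Q" and P: "is_functor D B P" and A: "A \<in> Obj B"
  shows "fibration (fibre E B (P \<circ>\<^sub>F Q) A) (fibre D B P A) (fibre_functor E B P Q A)"
proof -
  interpret Q: fibration E D Q by fact
  interpret PQ: is_functor E B "P \<circ>\<^sub>F Q" using Q.is_functor_axioms P by (rule is_functor_comp)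
  let ?E = "fibre E B (P \<circ>\<^sub>F Q) A" and ?D = "fibre D B P A" and ?Q = "fibre_functor E B P Q A"
  interpret QA: is_functor ?E ?D ?Q using Q.is_functor_axioms P A by (rule is_functor_fibre_functor)
  have o: "omap ?Q X = omap Q X" if "X \<in> Obj ?E" for X
    using that by (simp add: fibre_functor_def restrict_functor_def)
  have a: "amap ?Q f = amap Q f" if "f \<in> Arr ?E" for f
    using that by (simp add: fibre_functor_def restrict_functor_def)
  show ?thesis
  proof unfold_locales
    fix X u assume X: "X \<in> Obj ?E" and u: "u \<in> Arr ?D" "Cod ?D u = omap ?Q X"
    obtain h where h: "cartesian E D Q h" "Cod E h = X" "amap Q h = u"
      using Q.cartesian_lift[of X u] X u o[OF X] by auto
    have hA: "h \<in> Arr ?E" using h u(1) by (simp add: cartesian_def)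
    have "cartesian ?E ?D ?Q h"
      unfolding cartesian_def
    proof (intro conjI allI ballI impI hA)
      fix K k g
      assume k: "k \<in> Hom ?E K (Cod ?E h)" and g: "g \<in> Hom ?D (omap ?Q K) (omap ?Q (Dom ?E h))"
        and eq: "amap ?Q h \<odot>\<^bsub>?D\<^esub> g = amap ?Q k"
      have kA: "k \<in> Arr ?E" and K: "K \<in> Obj ?E"
        using k QA.source.Dom_in[of k] unfolding Hom_def by auto
      note simps = o[OF K] o[OF QA.source.Dom_in[OF hA]] a[OF hA] a[OF kA]
      have "\<exists>!l. l \<in> Hom E K (Dom E h) \<and> amap Q l = g \<and> h \<odot>\<^bsub>E\<^esub> l = k"
        using h(1) k g eq simps unfolding cartesian_def by (simp add: Hom_fibre)
      moreover have "l \<in> Hom ?E K (Dom ?E h) \<and> amap ?Q l = g \<and> h \<odot>\<^bsub>?E\<^esub> l = k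
          \<longleftrightarrow> l \<in> Hom E K (Dom E h) \<and> amap Q l = g \<and> h \<odot>\<^bsub>E\<^esub> l = k" for l
        using g a[of l] by (auto simp: Hom_def)
      ultimately show "\<exists>!l. l \<in> Hom ?E K (Dom ?E h) \<and> amap ?Q l = g \<and> h \<odot>\<^bsub>?E\<^esub> l = k"
        by simp
    qed
    then show "\<exists>h. cartesian ?E ?D ?Q h \<and> Cod ?E h = X \<and> amap ?Q h = u"
      using h a[OF hA] by auto
  qed
qed

end

theory Submission
  imports Defs
begin

text \<open>
  Let \<open>A\<close> be the domain of \<open>P (Q k)\<close>. Lift \<open>P (Q k)\<close> to a \<open>P\<close>-Cartesian arrow \<open>u\<close> ending where
  \<open>Q k\<close> ends, and then \<open>u\<close> to a \<open>Q\<close>-Cartesian arrow \<open>h\<close> ending where \<open>k\<close> ends. Built in these two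
  stages, \<open>h\<close> is Cartesian both for \<open>Q\<close> and for \<open>P \<circ>\<^sub>F Q\<close>. As \<open>h\<close> and \<open>k\<close> lie over the same arrow
  of \<open>B\<close>, Cartesianness of \<open>h\<close> for the composite factors \<open>k\<close> as \<open>h \<odot> v\<close> with \<open>v\<close> over the identity
  of \<open>A\<close>. Since \<open>h\<close> and \<open>h \<odot> v\<close> are both \<open>Q\<close>-Cartesian, so is \<open>v\<close> (\<open>cartesian_cancel_left\<close>); and a
  \<open>Q\<close>-Cartesian arrow over an identity of \<open>B\<close> stays Cartesian in its fibre
  (\<open>cartesian_fibre_functor\<close>).
\<close>

lemma cartesianE:
  assumes "cartesian E B R h" "k \<in> Hom E K (Cod E h)"
    and "g \<in> Hom B (omap R K) (omap R (Dom E h))" "amap R h \<odot>\<^bsub>B\<^esub> g = amap R k"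
  obtains l where "l \<in> Hom E K (Dom E h)" "amap R l = g" "h \<odot>\<^bsub>E\<^esub> l = k"
  using assms unfolding cartesian_def by blast

lemma cartesian_unique:
  assumes h: "cartesian E B R h" and F: "is_functor E B R"
    and l: "l \<in> Hom E K (Dom E h)" and l': "l' \<in> Hom E K (Dom E h)"
    and eq: "amap R l = amap R l'" "h \<odot>\<^bsub>E\<^esub> l = h \<odot>\<^bsub>E\<^esub> l'"
  shows "l = l'"
proof -
  interpret is_functor E B R by fact
  have hH: "h \<in> Hom E (Dom E h) (Cod E h)" using h by (simp add: cartesian_def HomI)
  have "\<exists>!x. x \<in> Hom E K (Dom E h) \<and> amap R x = amap R l \<and> h \<odot>\<^bsub>E\<^esub> x = h \<odot>\<^bsub>E\<^esub> l"
    using h source.Comp_in[OF l hH] amap_in[OF l] amap_Comp[OF l hH]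
    unfolding cartesian_def by simp
  moreover have "l' \<in> Hom E K (Dom E h) \<and> amap R l' = amap R l \<and> h \<odot>\<^bsub>E\<^esub> l' = h \<odot>\<^bsub>E\<^esub> l"
    using l' eq by simp
  ultimately show ?thesis using l by blast
qed

text \<open>
  To lift \<open>z\<close> through \<open>v\<close>, lift \<open>h \<odot> z\<close> through \<open>h \<odot> v\<close>: the result composes with \<open>v\<close> to \<open>z\<close>
  because both composites agree after \<open>h\<close> and have the same image, and \<open>h\<close> is Cartesian.
\<close>

lemma cartesian_cancel_left:
  assumes F: "is_functor E B R" and v: "v \<in> Arr E" "Cod E v = Dom E h"
    and h: "cartesian E B R h" and hv: "cartesian E B R (h \<odot>\<^bsub>E\<^esub> v)"
  shows "cartesian E B R v"
proof -
  interpret is_functor E B R by fact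
  have hH: "h \<in> Hom E (Dom E h) (Cod E h)" using h by (simp add: cartesian_def HomI)
  have vH: "v \<in> Hom E (Dom E v) (Dom E h)" using v by (simp add: Hom_def)
  have hvH: "h \<odot>\<^bsub>E\<^esub> v \<in> Hom E (Dom E v) (Cod E h)" using vH hH by (rule source.Comp_in)
  then have ends: "Dom E (h \<odot>\<^bsub>E\<^esub> v) = Dom E v" "Cod E (h \<odot>\<^bsub>E\<^esub> v) = Cod E h"
    by (simp_all add: Hom_def)
  show ?thesis
    unfolding cartesian_def v(2)
  proof (intro conjI allI ballI impI v(1))
    fix K z g
    assume z: "z \<in> Hom E K (Dom E h)" and g: "g \<in> Hom B (omap R K) (omap R (Dom E v))"
      and eq: "amap R v \<odot>\<^bsub>B\<^esub> g = amap R z"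
    have hz: "h \<odot>\<^bsub>E\<^esub> z \<in> Hom E K (Cod E h)" using z hH by (rule source.Comp_in)
    have img: "amap R (h \<odot>\<^bsub>E\<^esub> v) \<odot>\<^bsub>B\<^esub> g = amap R (h \<odot>\<^bsub>E\<^esub> z)"
      using target.Comp_assoc[OF g amap_in[OF vH] amap_in[OF hH]]
      by (simp add: amap_Comp[OF vH hH] amap_Comp[OF z hH] eq)
    obtain l where l: "l \<in> Hom E K (Dom E v)" "amap R l = g" "(h \<odot>\<^bsub>E\<^esub> v) \<odot>\<^bsub>E\<^esub> l = h \<odot>\<^bsub>E\<^esub> z"
      by (rule cartesianE[OF hv, unfolded ends, OF hz g img])
    have "v \<odot>\<^bsub>E\<^esub> l = z"
    proof (rule cartesian_unique[OF h F source.Comp_in[OF l(1) vH] z])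
      show "amap R (v \<odot>\<^bsub>E\<^esub> l) = amap R z" by (simp add: amap_Comp[OF l(1) vH] l(2) eq)
      show "h \<odot>\<^bsub>E\<^esub> (v \<odot>\<^bsub>E\<^esub> l) = h \<odot>\<^bsub>E\<^esub> z" using source.Comp_assoc[OF l(1) vH hH] l(3) by simp
    qed
    moreover have "l' = l" if "l' \<in> Hom E K (Dom E v)" "amap R l' = g" "v \<odot>\<^bsub>E\<^esub> l' = z" for l'
    proof (rule cartesian_unique[OF hv F, unfolded ends, OF that(1) l(1)])
      show "amap R l' = amap R l" using that(2) l(2) by simp
      show "(h \<odot>\<^bsub>E\<^esub> v) \<odot>\<^bsub>E\<^esub> l' = (h \<odot>\<^bsub>E\<^esub> v) \<odot>\<^bsub>E\<^esub> l"
        unfolding l(3) source.Comp_assoc[OF that(1) vH hH] that(3) ..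
    qed
    ultimately show "\<exists>!l. l \<in> Hom E K (Dom E v) \<and> amap R l = g \<and> v \<odot>\<^bsub>E\<^esub> l = z"
      using l by blast
  qed
qed

text \<open>
  A lifting problem in the fibre is one in \<open>E\<close>, and its solution is again an arrow of the fibre: it
  lies over an arrow \<open>g\<close> of the fibre of \<open>P\<close>, so its image in \<open>B\<close> is the identity.
\<close>

lemma cartesian_fibre_functor:
  assumes Q: "is_functor E D Q" and P: "is_functor D B P" and A: "A \<in> Obj B"
    and v: "cartesian E D Q v" and vert: "amap (P \<circ>\<^sub>F Q) v = Ident B A"
  shows "cartesian (fibre E B (P \<circ>\<^sub>F Q) A) (fibre D B P A) (fibre_functor E B P Q A) v"
proof -
  interpret PQ: is_functor E B "P \<circ>\<^sub>F Q" using Q P by (rule is_functor_comp)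
  let ?E = "fibre E B (P \<circ>\<^sub>F Q) A" and ?D = "fibre D B P A" and ?Q = "fibre_functor E B P Q A"
  interpret EA: category ?E using A by (rule PQ.category_fibre)
  have o: "omap ?Q X = omap Q X" if "X \<in> Obj ?E" for X
    using that by (simp add: fibre_functor_def restrict_functor_def)
  have a: "amap ?Q f = amap Q f" if "f \<in> Arr ?E" for f
    using that by (simp add: fibre_functor_def restrict_functor_def)
  have vA: "v \<in> Arr ?E" using v vert by (simp add: cartesian_def)
  show ?thesis
    unfolding cartesian_def
  proof (intro conjI allI ballI impI vA)
    fix K z g
    assume z: "z \<in> Hom ?E K (Cod ?E v)" and g: "g \<in> Hom ?D (omap ?Q K) (omap ?Q (Dom ?E v))"
      and eq: "amap ?Q v \<odot>\<^bsub>?D\<^esub> g = amap ?Q z"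
    have zA: "z \<in> Arr ?E" and K: "K \<in> Obj ?E"
      using z EA.Dom_in[of z] unfolding Hom_def by auto
    note simps = o[OF K] o[OF EA.Dom_in[OF vA]] a[OF vA] a[OF zA]
    have "\<exists>!l. l \<in> Hom E K (Dom E v) \<and> amap Q l = g \<and> v \<odot>\<^bsub>E\<^esub> l = z"
      using v z g eq simps unfolding cartesian_def by (simp add: Hom_fibre)
    moreover have "l \<in> Hom ?E K (Dom ?E v) \<and> amap ?Q l = g \<and> v \<odot>\<^bsub>?E\<^esub> l = z
        \<longleftrightarrow> l \<in> Hom E K (Dom E v) \<and> amap Q l = g \<and> v \<odot>\<^bsub>E\<^esub> l = z" for l
      using g a[of l] by (auto simp: Hom_def)
    ultimately show "\<exists>!l. l \<in> Hom ?E K (Dom ?E v) \<and> amap ?Q l = g \<and> v \<odot>\<^bsub>?E\<^esub> l = z"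
      by simp
  qed
qed

theorem lemma2p1p46:
  fixes E :: "('e, 'ea) category" and D :: "('d, 'da) category" and B :: "('b, 'ba) category"
    and Q :: "('e, 'ea, 'd, 'da) functor_maps" and P :: "('d, 'da, 'b, 'ba) functor_maps"
  assumes "fibration E D Q" and "fibration D B P"
    and "cartesian E D Q k"
  shows "\<exists>A \<in> Obj B. \<exists>h v.
           cartesian E B (P \<circ>\<^sub>F Q) h \<and>
           cartesian (fibre E B (P \<circ>\<^sub>F Q) A) (fibre D B P A) (fibre_functor E B P Q A) v \<and>
           Cod E v = Dom E h \<and> k = h \<odot>\<^bsub>E\<^esub> v"
proof -
  interpret Q: fibration E D Q by fact
  interpret P: fibration D B P by fact
  note functors = Q.is_functor_axioms P.is_functor_axioms
  interpret PQ: is_functor E B "P \<circ>\<^sub>F Q" using functors by (rule is_functor_comp)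
  have k: "k \<in> Arr E" using assms(3) by (simp add: cartesian_def)
  define f where "f = amap (P \<circ>\<^sub>F Q) k"
  define A where "A = Dom B f"
  have f: "f \<in> Arr B" "omap (P \<circ>\<^sub>F Q) (Dom E k) = A" "Cod B f = omap (P \<circ>\<^sub>F Q) (Cod E k)"
    using PQ.amap_ArrD[OF k] by (simp_all add: f_def A_def)
  then have A: "A \<in> Obj B" by (simp add: A_def P.target.Dom_in)
  obtain u where u: "cartesian D B P u" "Cod D u = omap Q (Cod E k)" "amap P u = f"
    using P.cartesian_lift[OF Q.omap_in[OF Q.source.Cod_in[OF k]] f(1)] f(3) by auto
  obtain h where h: "cartesian E D Q h" "Cod E h = Cod E k" "amap Q h = u"
    using Q.cartesian_lift[OF Q.source.Cod_in[OF k] _ u(2)] u(1) unfolding cartesian_def by blast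
  have hPQ: "cartesian E B (P \<circ>\<^sub>F Q) h"
    using cartesian_comp[OF functors h(1)] u(1) h(3) by simp
  have img: "amap (P \<circ>\<^sub>F Q) h = f" using h(3) u(3) by simp
  then have dom: "omap (P \<circ>\<^sub>F Q) (Dom E h) = A"
    using PQ.amap_ArrD(2)[of h] hPQ by (simp add: cartesian_def A_def)
  have "amap (P \<circ>\<^sub>F Q) h \<odot>\<^bsub>B\<^esub> Ident B A = amap (P \<circ>\<^sub>F Q) k"
    using P.target.Comp_Ident[OF HomI[OF f(1)]] by (simp only: img f_def A_def)
  then obtain v where v: "v \<in> Hom E (Dom E k) (Dom E h)" "amap (P \<circ>\<^sub>F Q) v = Ident B A"
      "h \<odot>\<^bsub>E\<^esub> v = k"
    using HomI[OF k] P.target.Ident_in[OF A]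
    by (elim cartesianE[OF hPQ, of k "Dom E k" "Ident B A", unfolded dom f(2) h(2)])
  have ends: "v \<in> Arr E" "Cod E v = Dom E h" using v(1) by (simp_all add: Hom_def)
  have "cartesian E D Q v"
    using cartesian_cancel_left[OF functors(1) ends h(1)] v(3) assms(3) by simp
  then have "cartesian (fibre E B (P \<circ>\<^sub>F Q) A) (fibre D B P A) (fibre_functor E B P Q A) v"
    using cartesian_fibre_functor[OF functors A _ v(2)] by simp
  then show ?thesis using A hPQ ends(2) v(3) by blast
qed

end
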